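(* Let $\mathcal M=(\pi_0,K,g)$ be a state-space model on $\mathcal X\subseteq\mathbb R^{d_x}$ (with fixed observations $y_{1:T}$) such that (i) for every $t\ge 1$ the likelihood function $g_t$ is continuous and bounded, $\|g_t\|_\infty<\infty$; (ii) for every $t\ge1$ the kernel $K_t$ is continuous in total variation: for every $x\in\mathcal X$ and $\epsilon>0$ there is $\delta_{\epsilon,x,t}>0$ such that $\|K_t(x,\cdot)-K_t(x',\cdot)\|_{TV}\le\epsilon$ for all $x'\in\mathcal X$ with $\|x-x'\|\le\delta_{\epsilon,x,t}$. Let $\{\alpha_t\}_{t\in\mathbb N}$ be a family of parametric nudging transformations for $\mathcal M$. Then there exists a sequence of positive parameters $\gamma_{1:T}=(\gamma_1,\dots,\gamma_T)$ such that the nudged model $\mathcal M^\alpha=(\pi_0,K^\alpha,g)$ constructed with the maps $\alpha_t(\cdot,\gamma_t)$, $t=1,\dots,T$, satisfies $$p_T(y_{1:T}\mid\mathcal M^\alpha)\ \ge\ p_T(y_{1:T}\mid\mathcal M).$$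
   Context: State-space model: $\mathcal X\subseteq\mathbb R^{d_x}$ is a Borel set with Borel $\sigma$-algebra $\mathcal B(\mathcal X)$. A state-space model $\mathcal M=(\pi_0,K,g)$ consists of a probability measure $\pi_0$ on $\mathcal X$, Markov kernels $K=\{K_t\}_{t\ge1}$ from $\mathcal X$ to $\mathcal X$, and measurable functions $g=\{g_t\}_{t\ge1}$, $g_t:\mathcal X\to[0,\infty)$, where $g_t(x)=g_t(y_t|x)$ is the likelihood of $x$ given the fixed observation $y_t$. Notation: $\mu(f)=\int f\,d\mu$, $K_t\pi(dx)=\int K_t(x',dx)\,\pi(dx')$, $\|f\|_\infty=\sup_x|f(x)|$. The predictive measures and filters are, recursively for $t\ge1$, $\xi_t=K_t\pi_{t-1}$ and $\pi_t(f)=\xi_t(fg_t)/\xi_t(g_t)$ (the normalising constants $\xi_t(g_t)$ are positive). The Bayesian evidence (marginal likelihood) is $p_T(y_{1:T}\mid\mathcal M)=\prod_{t=1}^T\xi_t(g_t)$. Total variation: $\|\mu\|_{TV}=|\sup_{F\in\mathcal B(\mathcal X)}\mu(F)-\inf_{F\in\mathcal B(\mathcal X)}\mu(F)|$. Family of parametric nudging transformations for $\mathcal M$: maps $\alpha_t:\mathcal X\times[0,\infty)\to\mathcal X$, $t\in\mathbb N$ (Borel measurable in $x$), such that (1) $\alpha_t(x,\gamma)$ is continuous in $\gamma$ and $\lim_{\gamma\to0}\alpha_t(x,\gamma)=x$ for all $x\in\mathcal X$, $t\ge1$; (2) there are $\Gamma_t>0$ with $g_t(\alpha_t(x,\gamma))-g_t(x)\ge0$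 for all $(x,\gamma)\in\mathcal X\times[0,\Gamma_t)$; (3) for every $t\ge1$ and $\gamma\in(0,\Gamma_t)$, $\Delta_{g_t}(\gamma):=\int_{\mathcal X}[g_t(\alpha_t(x,\gamma))-g_t(x)]\,\xi_t(dx)>0$. Nudged model: given $\gamma_{1:T}$, $\mathcal M^\alpha=(\pi_0,K^\alpha,g)$ with $K_t^\alpha(x_{t-1},dx_t)=\int\delta_{\alpha_t(x_t',\gamma_t)}(dx_t)\,K_t(x_{t-1},dx_t')$, i.e. $K_t^\alpha(x,\cdot)$ is the image of $K_t(x,\cdot)$ under $\alpha_t(\cdot,\gamma_t)$. Its predictive measures $\xi_t^\alpha=K_t^\alpha\pi^\alpha_{t-1}$, filters $\pi_t^\alpha(f)=\xi_t^\alpha(fg_t)/\xi_t^\alpha(g_t)$ (with $\pi_0^\alpha=\pi_0$) and evidence $p_T(y_{1:T}\mid\mathcal M^\alpha)=\prod_{t=1}^T\xi_t^\alpha(g_t)$ are defined by the same recursion; a statement about the evidence of $\mathcal M^\alpha$ includes that the normalising constants needed in the recursion are positive. *)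

theory Defs
  imports "HOL-Probability.Probability"
begin

text \<open>
  The state space is a Borel set \<open>X\<close> of a Euclidean space; the $\sigma$-algebra $\mathcal{B}(X)$ is
  carried by the measurable space \<open>restrict_space borel X\<close>, so all measures below live on \<open>X\<close>.
  Times are natural numbers; the components of \<open>kernel\<close> and \<open>likelihood\<close> at index 0 are never used.
  The observations are fixed and therefore absorbed in the likelihoods.
\<close>

record 'a ssm =
  initial :: "'a measure"
  kernel :: "nat \<Rightarrow> 'a \<Rightarrow> 'a measure"
  likelihood :: "nat \<Rightarrow> 'a \<Rightarrow> real"

definition state_space_model :: "'a::euclidean_space set \<Rightarrow> 'a ssm \<Rightarrow> bool" where
  "state_space_model X M \<longleftrightarrow>
     X \<in> sets borel \<and>
     initial M \<in> space (prob_algebra (restrict_space borel X)) \<and>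
     (\<forall>t\<ge>1. kernel M t \<in> restrict_space borel X \<rightarrow>\<^sub>M prob_algebra (restrict_space borel X)) \<and>
     (\<forall>t\<ge>1. likelihood M t \<in> borel_measurable (restrict_space borel X)) \<and>
     (\<forall>t\<ge>1. \<forall>x\<in>X. 0 \<le> likelihood M t x)"

text \<open>The measure $f \mapsto \xi(f g)/\xi(g)$.\<close>

definition bayes_update :: "('a \<Rightarrow> real) \<Rightarrow> 'a measure \<Rightarrow> 'a measure" where
  "bayes_update g \<xi> = density \<xi> (\<lambda>x. ennreal (g x / (\<integral>y. g y \<partial>\<xi>)))"

primrec filter_measure :: "'a ssm \<Rightarrow> nat \<Rightarrow> 'a measure" where
  "filter_measure M 0 = initial M"
| "filter_measure M (Suc t) =
     bayes_update (likelihood M (Suc t)) (filter_measure M t \<bind> kernel M (Suc t))"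

text \<open>Only meaningful for \<open>t \<ge> 1\<close>.\<close>

definition predictive :: "'a ssm \<Rightarrow> nat \<Rightarrow> 'a measure" where
  "predictive M t = filter_measure M (t - 1) \<bind> kernel M t"

definition norm_const :: "'a ssm \<Rightarrow> nat \<Rightarrow> real" where
  "norm_const M t = (\<integral>x. likelihood M t x \<partial>predictive M t)"

definition evidence :: "'a ssm \<Rightarrow> nat \<Rightarrow> real" where
  "evidence M T = (\<Prod>t=1..T. norm_const M t)"

text \<open>Total variation of a bounded signed measure \<open>\<mu>\<close>, given as a set function on the $\sigma$-algebra of \<open>S\<close>.\<close>

definition tv_norm :: "'a measure \<Rightarrow> ('a set \<Rightarrow> real) \<Rightarrow> real" where
  "tv_norm S \<mu> = \<bar>(SUP F\<in>sets S. \<mu> F) - (INF F\<in>sets S. \<mu> F)\<bar>"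

definition tv_continuous_kernel :: "'a::euclidean_space set \<Rightarrow> ('a \<Rightarrow> 'a measure) \<Rightarrow> bool" where
  "tv_continuous_kernel X k \<longleftrightarrow>
     (\<forall>x\<in>X. \<forall>\<epsilon>>0. \<exists>\<delta>>0. \<forall>x'\<in>X. norm (x - x') \<le> \<delta> \<longrightarrow>
        tv_norm (restrict_space borel X) (\<lambda>F. measure (k x) F - measure (k x') F) \<le> \<epsilon>)"

text \<open>
  The measurability condition includes that \<open>\<alpha> t\<close> maps $X \times [0,\infty)$ into \<open>X\<close>.
\<close>

definition nudging_family ::
  "'a::euclidean_space set \<Rightarrow> 'a ssm \<Rightarrow> (nat \<Rightarrow> 'a \<Rightarrow> real \<Rightarrow> 'a) \<Rightarrow> bool" where
  "nudging_family X M \<alpha> \<longleftrightarrow>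
     (\<forall>t\<ge>1. \<forall>\<gamma>\<ge>0. (\<lambda>x. \<alpha> t x \<gamma>) \<in> restrict_space borel X \<rightarrow>\<^sub>M restrict_space borel X) \<and>
     (\<forall>t\<ge>1. \<forall>x\<in>X. continuous_on {0..} (\<alpha> t x) \<and> (\<alpha> t x \<longlongrightarrow> x) (at_right 0)) \<and>
     (\<exists>\<Gamma>::nat \<Rightarrow> real. \<forall>t\<ge>1. 0 < \<Gamma> t \<and>
        (\<forall>x\<in>X. \<forall>\<gamma>\<in>{0..<\<Gamma> t}. likelihood M t (\<alpha> t x \<gamma>) - likelihood M t x \<ge> 0) \<and>
        (\<forall>\<gamma>\<in>{0<..<\<Gamma> t}.
           (\<integral>x. likelihood M t (\<alpha> t x \<gamma>) - likelihood M t x \<partial>predictive M t) > 0))"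

definition nudged_model ::
  "'a::euclidean_space set \<Rightarrow> (nat \<Rightarrow> 'a \<Rightarrow> real \<Rightarrow> 'a) \<Rightarrow> (nat \<Rightarrow> real) \<Rightarrow> 'a ssm \<Rightarrow> 'a ssm" where
  "nudged_model X \<alpha> \<gamma> M =
     M\<lparr>kernel := \<lambda>t x. distr (kernel M t x) (restrict_space borel X) (\<lambda>x'. \<alpha> t x' (\<gamma> t))\<rparr>"

end

theory Submission
  imports Defs
begin

text \<open>
  The evidence is an iterated integral, \<open>backward M n t x\<close> being the part contributed by the times
  \<open>t + 1, \<dots>, t + n\<close> to a trajectory that is in \<open>x\<close> at time \<open>t\<close>. Nudging only at the last time \<open>T\<close>
  strictly increases the evidence, by the third property of a nudging family. The nudging is then
  switched on at the times \<open>T - 1, \<dots>, 1\<close> successively: as the kernels are continuous in total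
  variation, \<open>backward\<close> is continuous even for nudged kernels, so the evidence depends continuously
  on the new parameter at \<open>0\<close> by dominated convergence, and the strict inequality survives if this
  parameter is small enough.
\<close>

section \<open>Integrals against kernels\<close>

text \<open>\<open>bind\<close> is the \<open>join\<close> of the image measure of \<open>M\<close>
  under \<open>K\<close>, and a bounded integrand may be integrated iteratively over a
  \<open>join\<close>, since this image measure is finite and concentrated on measures of mass at
  most 1.\<close>

lemma (in subprob_space) integral_bind_bounded:
  fixes f :: "'b \<Rightarrow> real"
  assumes K: "K \<in> M \<rightarrow>\<^sub>M subprob_algebra N"
    and f: "f \<in> borel_measurable N"
    and B: "\<And>x. x \<in> space N \<Longrightarrow> \<bar>f x\<bar> \<le> B"
  shows "(\<integral>y. f y \<partial>(M \<bind> K)) = (\<integral>x. \<integral>y. f y \<partial>K x \<partial>M)"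
proof -
  let ?D = "distr M (subprob_algebra N) K"
  have "(\<integral>y. f y \<partial>join ?D) = (\<integral>M'. (\<integral>y. f y \<partial>M') \<partial>?D)"
  proof (rule integral_join[OF f B])
    show "finite_measure ?D"
      by (rule finite_measure_distr[OF K])
    have "AE x in M. emeasure (K x) (space (K x)) \<le> 1"
      using subprob_space.subprob_emeasure_le_1[OF subprob_space_kernel[OF K]] by auto
    then show "AE M' in ?D. emeasure M' (space M') \<le> ennreal 1"
      using K by (subst AE_distr_iff) auto
  qed auto
  also have "\<dots> = (\<integral>x. \<integral>y. f y \<partial>K x \<partial>M)"
    using K f by (intro integral_distr) auto
  finally show ?thesis
    by (simp add: bind_nonempty''[OF K subprob_not_empty])
qed

text \<open>The empty set contributes the value 0, so the infimum is at most 0 and the supremum at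
  least 0; their distance dominates the absolute value of every difference. The bound 1 on the
  differences makes both extrema meaningful in the reals.\<close>

lemma tv_norm_ge:
  assumes "prob_space P" "prob_space Q" "F \<in> sets S"
  shows "\<bar>measure P F - measure Q F\<bar> \<le> tv_norm S (\<lambda>F. measure P F - measure Q F)"
proof -
  let ?d = "\<lambda>F. measure P F - measure Q F"
  have bd: "\<bar>?d F\<bar> \<le> 1" for F
    using prob_space.prob_le_1[OF assms(1), of F] prob_space.prob_le_1[OF assms(2), of F]
      measure_nonneg[of P F] measure_nonneg[of Q F] by linarith
  have ba: "bdd_above (?d ` sets S)"
    using bd by (intro bdd_aboveI[of _ 1]) (auto simp: abs_le_iff)
  have bb: "bdd_below (?d ` sets S)"
    using bd by (intro bdd_belowI[of _ "-1"]) (smt (verit) imageE)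
  have "?d F \<le> (SUP F\<in>sets S. ?d F)" "(INF F\<in>sets S. ?d F) \<le> ?d F"
    "?d {} \<le> (SUP F\<in>sets S. ?d F)" "(INF F\<in>sets S. ?d F) \<le> ?d {}"
    using assms(3) cSUP_upper[OF _ ba] cINF_lower[OF bb] by blast+
  then show ?thesis
    unfolding tv_norm_def by simp
qed

lemma continuous_on_measure_tv_continuous_kernel:
  assumes tv: "tv_continuous_kernel X k"
    and prob: "\<And>x. x \<in> X \<Longrightarrow> prob_space (k x)"
    and F: "F \<in> sets (restrict_space borel X)"
  shows "continuous_on X (\<lambda>x. measure (k x) F)"
  unfolding continuous_on_iff
proof (intro ballI allI impI)
  fix x and e :: real assume x: "x \<in> X" and "0 < e"
  \<comment> \<open>Half of \<open>e\<close> turns the non-strict bound of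
    \<open>tv_continuous_kernel\<close> into the strict one required here.\<close>
  then obtain d where d: "d > 0" and le: "\<And>x'. x' \<in> X \<Longrightarrow> norm (x - x') \<le> d \<Longrightarrow>
        tv_norm (restrict_space borel X) (\<lambda>F. measure (k x) F - measure (k x') F) \<le> e / 2"
    using tv unfolding tv_continuous_kernel_def by (meson half_gt_zero)
  have "dist (measure (k x') F) (measure (k x) F) < e" if "x' \<in> X" "dist x' x < d" for x'
  proof -
    have "norm (x - x') \<le> d"
      using that by (simp add: dist_norm norm_minus_commute)
    then have "\<bar>measure (k x) F - measure (k x') F\<bar> \<le> e / 2"
      using le[OF \<open>x' \<in> X\<close>] tv_norm_ge[OF prob[OF x] prob[OF \<open>x' \<in> X\<close>] F] by linarith
    then show ?thesis
      using \<open>0 < e\<close> unfolding dist_real_def by linarith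
  qed
  with d show "\<exists>d>0. \<forall>x'\<in>X. dist x' x < d \<longrightarrow> dist (measure (k x') F) (measure (k x) F) < e"
    by blast
qed

text \<open>
  Continuity passes from indicators to bounded measurable functions, since the latter are
  uniform limits of the finite combinations \<open>\<lfloor>n f\<rfloor> / n\<close> of indicators.
\<close>

lemma continuous_on_integral_tv_continuous_kernel:
  fixes f :: "'a::euclidean_space \<Rightarrow> real"
  assumes tv: "tv_continuous_kernel X k"
    and k: "\<And>x. x \<in> X \<Longrightarrow> k x \<in> space (prob_algebra (restrict_space borel X))"
    and f: "f \<in> borel_measurable (restrict_space borel X)"
    and B: "\<And>x. x \<in> X \<Longrightarrow> \<bar>f x\<bar> \<le> B"
  shows "continuous_on X (\<lambda>x. \<integral>y. f y \<partial>k x)"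
proof -
  let ?S = "restrict_space borel X"
  have prob: "prob_space (k x)" and sets: "sets (k x) = sets ?S" if "x \<in> X" for x
    using k[OF that] by (auto simp: space_prob_algebra)
  have space: "space (k x) = X" if "x \<in> X" for x
    using sets_eq_imp_space_eq[OF sets[OF that]] by (simp add: space_restrict_space)
  have meas: "h \<in> borel_measurable (k x)" if "x \<in> X" "h \<in> borel_measurable ?S"
    for x and h :: "'a \<Rightarrow> real"
    using that(2) measurable_cong_sets[OF sets[OF that(1)] refl] by auto
  define F where "F n j = {y \<in> X. \<lfloor>real (Suc n) * f y\<rfloor> = j}" for n j
  \<comment> \<open>Finite, yet containing every value of the floor on \<open>X\<close>, because
    \<open>f\<close> is bounded by \<open>B\<close>. Using \<open>Suc n\<close> keeps the
    denominators nonzero.\<close>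
  define J where "J n = {- \<lceil>real (Suc n) * B\<rceil> - 1 .. \<lceil>real (Suc n) * B\<rceil> + 1}" for n
  define s where "s n y = (\<Sum>j\<in>J n. real_of_int j / real (Suc n) * indicator (F n j) y)"
    for n and y
  have F: "F n j \<in> sets ?S" for n j
  proof -
    have "{y \<in> space ?S. \<lfloor>real (Suc n) * f y\<rfloor> = j} \<in> sets ?S"
      using f by measurable
    then show ?thesis
      by (simp add: F_def space_restrict_space)
  qed
  have s_eq: "s n y = real_of_int \<lfloor>real (Suc n) * f y\<rfloor> / real (Suc n)" if y: "y \<in> X" for n y
  proof -
    have "\<bar>real (Suc n) * f y\<bar> \<le> real (Suc n) * B"
      using B[OF y] by (simp add: abs_mult mult_left_mono del: of_nat_Suc)
    then have "\<lfloor>real (Suc n) * f y\<rfloor> \<in> J n"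
      unfolding J_def atLeastAtMost_iff abs_le_iff by linarith
    \<comment> \<open>The level sets \<open>F n j\<close> are disjoint: only the index equal to the
      floor at \<open>y\<close> contributes.\<close>
    then have "s n y = (\<Sum>j\<in>J n. if j = \<lfloor>real (Suc n) * f y\<rfloor>
        then real_of_int \<lfloor>real (Suc n) * f y\<rfloor> / real (Suc n) else 0)"
      unfolding s_def using y by (intro sum.cong) (auto simp: F_def J_def)
    also have "\<dots> = real_of_int \<lfloor>real (Suc n) * f y\<rfloor> / real (Suc n)"
      using \<open>_ \<in> J n\<close> by (simp add: J_def)
    finally show ?thesis .
  qed
  have s_close: "\<bar>s n y - f y\<bar> \<le> 1 / real (Suc n)" if y: "y \<in> X" for n y
  proof -
    have "\<bar>real_of_int \<lfloor>real (Suc n) * f y\<rfloor> - real (Suc n) * f y\<bar> \<le> 1"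
      by linarith
    moreover have "s n y - f y
        = (real_of_int \<lfloor>real (Suc n) * f y\<rfloor> - real (Suc n) * f y) / real (Suc n)"
      unfolding s_eq[OF y] by (simp add: diff_divide_distrib del: of_nat_Suc)
    ultimately show ?thesis
      by (simp add: abs_divide divide_right_mono del: of_nat_Suc)
  qed
  have s_meas: "s n \<in> borel_measurable ?S" for n
    unfolding s_def using F by measurable
  have int: "integrable (k x) f" "integrable (k x) (s n)" if x: "x \<in> X" for x n
  proof -
    interpret prob_space "k x" by (rule prob[OF x])
    show "integrable (k x) f"
      using B by (intro integrable_const_bound[of _ B] meas[OF x f]) (auto simp: space[OF x])
    have "\<bar>s n y\<bar> \<le> B + 1 / real (Suc n)" if "y \<in> X" for y
      using B[OF that] s_close[OF that, of n] by linarith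
    then show "integrable (k x) (s n)"
      by (intro integrable_const_bound[of _ "B + 1 / real (Suc n)"] meas[OF x s_meas])
        (auto simp: space[OF x])
  qed
  have s_int: "(\<integral>y. s n y \<partial>k x) = (\<Sum>j\<in>J n. real_of_int j / real (Suc n) * measure (k x) (F n j))"
    if x: "x \<in> X" for n x
  proof -
    interpret prob_space "k x" by (rule prob[OF x])
    have "F n j \<in> sets (k x)" for j
      using F sets[OF x] by simp
    then show ?thesis
      unfolding s_def
      by (subst Bochner_Integration.integral_sum)
        (auto intro!: integrable_mult_right integrable_real_indicator
          simp: less_top[symmetric] simp del: times_divide_eq_left of_nat_Suc)
  qed
  have cont: "continuous_on X (\<lambda>x. \<integral>y. s n y \<partial>k x)" for n
  proof -
    have "continuous_on X
        (\<lambda>x. \<Sum>j\<in>J n. real_of_int j / real (Suc n) * measure (k x) (F n j))"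
      by (intro continuous_intros
          continuous_on_measure_tv_continuous_kernel[OF tv prob F])
    then show ?thesis
      using s_int by (simp cong: continuous_on_cong)
  qed
  \<comment> \<open>Each \<open>k x\<close> has mass 1, so the pointwise error of \<open>s n\<close>
    passes to the integrals with a bound independent of \<open>x\<close>.\<close>
  have "uniform_limit X (\<lambda>n x. \<integral>y. s n y \<partial>k x) (\<lambda>x. \<integral>y. f y \<partial>k x) sequentially"
  proof (rule uniform_limitI)
    fix e :: real assume "0 < e"
    then obtain N where N: "1 / real (Suc N) < e"
      using reals_Archimedean[of e] by (auto simp: divide_inverse)
    have "dist (\<integral>y. s n y \<partial>k x) (\<integral>y. f y \<partial>k x) < e" if "n \<ge> N" "x \<in> X" for n x
    proof -
      interpret prob_space "k x" by (rule prob[OF \<open>x \<in> X\<close>])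
      note i = int[OF \<open>x \<in> X\<close>]
      have "\<bar>(\<integral>y. s n y \<partial>k x) - (\<integral>y. f y \<partial>k x)\<bar> = \<bar>\<integral>y. s n y - f y \<partial>k x\<bar>"
        using i by simp
      also have "\<dots> \<le> (\<integral>y. \<bar>s n y - f y\<bar> \<partial>k x)"
        by (rule integral_abs_bound)
      also have "\<dots> \<le> (\<integral>y. 1 / real (Suc n) \<partial>k x)"
        using i s_close by (intro integral_mono) (auto simp: space[OF \<open>x \<in> X\<close>])
      also have "\<dots> = 1 / real (Suc n)"
        by (simp add: prob_space)
      also have "\<dots> \<le> 1 / real (Suc N)"
        using that by (simp add: frac_le)
      finally show ?thesis
        using N by (simp add: dist_real_def)
    qed
    then show "\<forall>\<^sub>F n in sequentially. \<forall>x\<in>X. dist (\<integral>y. s n y \<partial>k x) (\<integral>y. f y \<partial>k x) < e"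
      unfolding eventually_sequentially by blast
  qed
  then show ?thesis
    by (rule uniform_limit_theorem[rotated]) (simp_all only: cont eventually_True trivial_limit_sequentially not_False_eq_True)
qed

section \<open>Evidence as an iterated integral\<close>

text \<open>The backward information function of smoothing: the likelihood of the observations at
  times \<open>t + 1\<close> to \<open>t + n\<close> given the state at time \<open>t\<close>. The
  observation at time \<open>t\<close> itself is excluded.\<close>

fun backward :: "'a ssm \<Rightarrow> nat \<Rightarrow> nat \<Rightarrow> 'a \<Rightarrow> real" where
  "backward M 0 t x = 1"
| "backward M (Suc n) t x =
     (\<integral>y. likelihood M (Suc t) y * backward M n (Suc t) y \<partial>kernel M (Suc t) x)"

text \<open>To be interpreted for \<open>M\<close> and for its nudged models alike. For the latter,
  positivity of the normalising constants is a conclusion, so the results of this locale allow them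
  to vanish.\<close>

locale bounded_ssm =
  fixes X :: "'a::euclidean_space set" and M :: "'a ssm"
  assumes ssm: "state_space_model X M"
    and bounded_likelihood: "t \<ge> 1 \<Longrightarrow> bounded (likelihood M t ` X)"
begin

abbreviation S where "S \<equiv> restrict_space borel X"

lemma space_S: "space S = X"
  by (simp add: space_restrict_space)

lemma kernel_measurable: "t \<ge> 1 \<Longrightarrow> kernel M t \<in> S \<rightarrow>\<^sub>M prob_algebra S"
  using ssm unfolding state_space_model_def by blast

lemma kernel_measurable_subprob: "t \<ge> 1 \<Longrightarrow> kernel M t \<in> S \<rightarrow>\<^sub>M subprob_algebra S"
  using kernel_measurable by (rule measurable_prob_algebraD)

lemma kernel_in_space: "t \<ge> 1 \<Longrightarrow> x \<in> X \<Longrightarrow> kernel M t x \<in> space (prob_algebra S)"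
  using measurable_space[OF kernel_measurable, of t x] by (simp add: space_S)

lemma likelihood_measurable: "t \<ge> 1 \<Longrightarrow> likelihood M t \<in> borel_measurable S"
  and likelihood_nonneg: "t \<ge> 1 \<Longrightarrow> x \<in> X \<Longrightarrow> 0 \<le> likelihood M t x"
  using ssm unfolding state_space_model_def by blast+

lemma likelihood_bound:
  assumes "t \<ge> 1"
  obtains B where "B \<ge> 0" "\<And>x. x \<in> X \<Longrightarrow> \<bar>likelihood M t x\<bar> \<le> B"
proof -
  obtain b where "b > 0" "\<forall>y\<in>likelihood M t ` X. norm y \<le> b"
    using bounded_likelihood[OF assms] unfolding bounded_pos by blast
  then show thesis
    by (intro that[of b]) auto
qed

section \<open>Filters and predictive measures as subprobability measures\<close>

lemma likelihood_integrable:
  assumes "t \<ge> 1" "\<mu> \<in> space (subprob_algebra S)"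
  shows "integrable \<mu> (likelihood M t)"
proof -
  interpret subprob_space \<mu> using assms(2) by (simp add: space_subprob_algebra)
  have sets: "sets \<mu> = sets S" using assms(2) by (simp add: space_subprob_algebra)
  obtain B where "\<And>x. x \<in> X \<Longrightarrow> \<bar>likelihood M t x\<bar> \<le> B"
    using likelihood_bound[OF assms(1)] by metis
  then show ?thesis
    using likelihood_measurable[OF assms(1)] measurable_cong_sets[OF sets refl]
      sets_eq_imp_space_eq[OF sets]
    by (intro integrable_const_bound[of _ B]) (auto simp: space_S)
qed

text \<open>The total mass is \<open>?c / ?c\<close>. This is 1, or 0 if the normalising constant
  vanishes, by the convention that division by 0 gives 0. Hence the use of subprobability
  measures.\<close>

lemma bayes_update_in_space:
  assumes "t \<ge> 1" and \<xi>: "\<xi> \<in> space (subprob_algebra S)"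
  shows "bayes_update (likelihood M t) \<xi> \<in> space (subprob_algebra S)"
proof -
  let ?g = "likelihood M t"
  let ?c = "\<integral>y. ?g y \<partial>\<xi>"
  have sets: "sets \<xi> = sets S" and sp: "subprob_space \<xi>"
    using \<xi> by (auto simp: space_subprob_algebra)
  have space: "space \<xi> = X" using sets_eq_imp_space_eq[OF sets] by (simp add: space_S)
  have int: "integrable \<xi> ?g" by (rule likelihood_integrable[OF assms])
  have nonneg: "AE x in \<xi>. 0 \<le> ?g x"
    using likelihood_nonneg[OF assms(1)] by (auto simp: space)
  have c: "0 \<le> ?c" by (rule integral_nonneg_AE[OF nonneg])
  have meas: "?g \<in> borel_measurable \<xi>" using int by auto
  have "emeasure (bayes_update ?g \<xi>) (space \<xi>) = (\<integral>\<^sup>+x. ennreal (?g x / ?c) \<partial>\<xi>)"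
    unfolding bayes_update_def using meas
    by (subst emeasure_density) (auto intro!: nn_integral_cong)
  also have "\<dots> = ennreal (\<integral>x. ?g x / ?c \<partial>\<xi>)"
    using int nonneg c by (intro nn_integral_eq_integral) auto
  also have "\<dots> \<le> 1"
    by simp
  finally show ?thesis
    using sets sp subprob_space.subprob_not_empty[OF sp]
    by (auto simp: space_subprob_algebra bayes_update_def intro!: subprob_spaceI)
qed

lemma bind_kernel_in_space:
  assumes "t \<ge> 1" and \<mu>: "\<mu> \<in> space (subprob_algebra S)"
  shows "\<mu> \<bind> kernel M t \<in> space (subprob_algebra S)"
proof -
  interpret subprob_space \<mu> using \<mu> by (simp add: space_subprob_algebra)
  have "sets \<mu> = sets S" using \<mu> by (simp add: space_subprob_algebra)
  then show ?thesis
    using kernel_measurable_subprob[OF assms(1)] measurable_cong_sets[of \<mu> S]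
    by (intro bind_in_space) auto
qed

lemma filter_measure_in_space: "filter_measure M t \<in> space (subprob_algebra S)"
proof (induction t)
  case 0
  have "initial M \<in> space (prob_algebra S)"
    using ssm unfolding state_space_model_def by blast
  then show ?case
    by (auto simp: space_prob_algebra space_subprob_algebra intro: prob_space_imp_subprob_space)
next
  case (Suc t)
  then show ?case
    using bayes_update_in_space bind_kernel_in_space by simp
qed

lemma predictive_in_space: "t \<ge> 1 \<Longrightarrow> predictive M t \<in> space (subprob_algebra S)"
  unfolding predictive_def using bind_kernel_in_space filter_measure_in_space by blast

lemma space_filter_measure: "space (filter_measure M t) = X"
  using filter_measure_in_space[of t] sets_eq_imp_space_eq[of "filter_measure M t" S]
  by (simp add: space_subprob_algebra space_S)

lemma norm_const_nonneg: "t \<ge> 1 \<Longrightarrow> norm_const M t \<ge> 0"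
  using predictive_in_space[of t] sets_eq_imp_space_eq[of "predictive M t" S] likelihood_nonneg
  unfolding norm_const_def space_subprob_algebra
  by (intro integral_nonneg_AE) (auto simp: space_S)

text \<open>The multiplied-out form of the filter update survives a vanishing constant: a
  nonnegative likelihood with integral 0 is 0 almost everywhere, so both sides are 0.\<close>

lemma norm_const_integral_bayes_update:
  fixes h :: "'a \<Rightarrow> real"
  assumes "t \<ge> 1" and \<xi>: "\<xi> \<in> space (subprob_algebra S)" and h: "h \<in> borel_measurable S"
  shows "(\<integral>x. likelihood M t x \<partial>\<xi>) * (\<integral>x. h x \<partial>bayes_update (likelihood M t) \<xi>)
    = (\<integral>x. likelihood M t x * h x \<partial>\<xi>)"
proof -
  let ?g = "likelihood M t"
  let ?c = "\<integral>y. ?g y \<partial>\<xi>"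
  have sets: "sets \<xi> = sets S"
    using \<xi> by (auto simp: space_subprob_algebra)
  have space: "space \<xi> = X" using sets_eq_imp_space_eq[OF sets] by (simp add: space_S)
  have int: "integrable \<xi> ?g" by (rule likelihood_integrable[OF assms(1,2)])
  have nonneg: "AE x in \<xi>. 0 \<le> ?g x"
    using likelihood_nonneg[OF assms(1)] by (auto simp: space)
  have c: "0 \<le> ?c" by (rule integral_nonneg_AE[OF nonneg])
  have hm: "h \<in> borel_measurable \<xi>"
    using h measurable_cong_sets[OF sets refl] by auto
  have "(\<integral>x. h x \<partial>bayes_update ?g \<xi>) = (\<integral>x. ?g x / ?c * h x \<partial>\<xi>)"
    unfolding bayes_update_def using int nonneg c hm by (subst integral_density) auto
  also have "\<dots> = (\<integral>x. ?g x * h x \<partial>\<xi>) / ?c"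
    by simp
  finally have eq: "(\<integral>x. h x \<partial>bayes_update ?g \<xi>) = (\<integral>x. ?g x * h x \<partial>\<xi>) / ?c" .
  show ?thesis
  proof (cases "?c = 0")
    case True
    then have "AE x in \<xi>. ?g x = 0"
      using integral_nonneg_eq_0_iff_AE[OF int nonneg] by simp
    then have "(\<integral>x. ?g x * h x \<partial>\<xi>) = 0"
      by (intro integral_eq_zero_AE) auto
    with True show ?thesis by simp
  qed (simp add: eq)
qed

text \<open>Both properties share one induction because the bound needs integrability, hence
  measurability, of the preceding integrand. As kernels have mass 1, the bounds of the likelihoods
  simply multiply. The time varies since the recursion moves it forward.\<close>

lemma backward_bounded_measurable:
  "backward M n t \<in> borel_measurable S \<and> (\<exists>B\<ge>0. \<forall>x\<in>X. \<bar>backward M n t x\<bar> \<le> B)"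
proof (induction n arbitrary: t)
  case 0
  have "backward M 0 t = (\<lambda>_. 1)" by auto
  then show ?case by (auto intro: exI[of _ 1])
next
  case (Suc n)
  let ?h = "\<lambda>y. likelihood M (Suc t) y * backward M n (Suc t) y"
  have [measurable]: "?h \<in> borel_measurable S"
    using Suc[of "Suc t"] likelihood_measurable[of "Suc t"] by auto
  have [measurable]: "kernel M (Suc t) \<in> S \<rightarrow>\<^sub>M subprob_algebra S"
    by (rule kernel_measurable_subprob) simp
  have "(\<lambda>x. \<integral>y. ?h y \<partial>kernel M (Suc t) x) \<in> borel_measurable S"
    by (rule measurable_compose[OF _ integral_measurable_subprob_algebra]) measurable
  moreover have "(\<lambda>x. \<integral>y. ?h y \<partial>kernel M (Suc t) x) = backward M (Suc n) t"
    by auto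
  ultimately have meas: "backward M (Suc n) t \<in> borel_measurable S"
    by simp
  obtain B1 B2 where B: "B1 \<ge> 0" "B2 \<ge> 0" "\<And>x. x \<in> X \<Longrightarrow> \<bar>backward M n (Suc t) x\<bar> \<le> B1"
    "\<And>x. x \<in> X \<Longrightarrow> \<bar>likelihood M (Suc t) x\<bar> \<le> B2"
    using Suc[of "Suc t"] likelihood_bound[of "Suc t"] by (metis le_add1 plus_1_eq_Suc)
  have le: "\<bar>?h y\<bar> \<le> B2 * B1" if "y \<in> X" for y
    using B that by (auto simp: abs_mult intro!: mult_mono)
  have "\<bar>backward M (Suc n) t x\<bar> \<le> B2 * B1" if x: "x \<in> X" for x
  proof -
    have k: "prob_space (kernel M (Suc t) x)" "sets (kernel M (Suc t) x) = sets S"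
      using kernel_in_space[of "Suc t" x] x by (auto simp: space_prob_algebra)
    then have sp: "space (kernel M (Suc t) x) = X"
      using sets_eq_imp_space_eq space_S by blast
    interpret prob_space "kernel M (Suc t) x" by fact
    have "integrable (kernel M (Suc t) x) ?h"
      using le \<open>?h \<in> borel_measurable S\<close> measurable_cong_sets[OF k(2) refl, of borel]
      by (intro integrable_const_bound[of _ "B2 * B1"]) (auto simp: sp)
    then have "\<bar>\<integral>y. ?h y \<partial>kernel M (Suc t) x\<bar> \<le> (\<integral>y. B2 * B1 \<partial>kernel M (Suc t) x)"
      using le by (intro order_trans[OF integral_abs_bound] integral_mono) (auto simp: sp)
    also have "\<dots> = B2 * B1" by (simp add: prob_space)
    finally show ?thesis by simp
  qed
  then show ?case
    using B meas by (intro conjI exI[of _ "B2 * B1"]) auto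
qed

lemma backward_measurable: "backward M n t \<in> borel_measurable S"
  and backward_bound: "\<exists>B\<ge>0. \<forall>x\<in>X. \<bar>backward M n t x\<bar> \<le> B"
  using backward_bounded_measurable by blast+

section \<open>Factorisation of the evidence at a given time\<close>

lemma integral_bind_kernel:
  fixes f :: "'a \<Rightarrow> real"
  assumes "t \<ge> 1" "\<mu> \<in> space (subprob_algebra S)" "f \<in> borel_measurable S"
    and "\<And>x. x \<in> X \<Longrightarrow> \<bar>f x\<bar> \<le> B"
  shows "(\<integral>y. f y \<partial>(\<mu> \<bind> kernel M t)) = (\<integral>x. \<integral>y. f y \<partial>kernel M t x \<partial>\<mu>)"
proof -
  interpret subprob_space \<mu> using assms(2) by (simp add: space_subprob_algebra)
  have "sets \<mu> = sets S" using assms(2) by (simp add: space_subprob_algebra)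
  then have "kernel M t \<in> \<mu> \<rightarrow>\<^sub>M subprob_algebra S"
    using kernel_measurable_subprob[OF assms(1)] measurable_cong_sets[of \<mu> S] by auto
  from integral_bind_bounded[OF this assms(3), of B] assms(4) show ?thesis
    by (simp add: space_S)
qed

lemma likelihood_backward_bound:
  assumes "s \<ge> 1"
  shows "\<exists>B. \<forall>x\<in>X. \<bar>likelihood M s x * backward M n t x\<bar> \<le> B"
proof -
  obtain B1 B2 where B: "B1 \<ge> 0" "B2 \<ge> 0" "\<And>x. x \<in> X \<Longrightarrow> \<bar>backward M n t x\<bar> \<le> B1"
    "\<And>x. x \<in> X \<Longrightarrow> \<bar>likelihood M s x\<bar> \<le> B2"
    using backward_bound[of n t] likelihood_bound[OF assms] by metis
  then show ?thesis
    by (intro exI[of _ "B2 * B1"]) (auto simp: abs_mult intro!: mult_mono)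
qed

text \<open>Integrating the kernel in the recursion of \<open>backward\<close> against the filter
  produces the predictive measure; boundedness of the integrand justifies the iterated
  integral.\<close>

lemma integral_backward_Suc:
  "(\<integral>x. backward M (Suc n) t x \<partial>filter_measure M t) =
     (\<integral>y. likelihood M (Suc t) y * backward M n (Suc t) y \<partial>predictive M (Suc t))"
proof -
  have m: "(\<lambda>y. likelihood M (Suc t) y * backward M n (Suc t) y) \<in> borel_measurable S"
    using backward_measurable likelihood_measurable[of "Suc t"] by auto
  obtain B where "\<And>x. x \<in> X \<Longrightarrow> \<bar>likelihood M (Suc t) x * backward M n (Suc t) x\<bar> \<le> B"
    using likelihood_backward_bound[of "Suc t"] by (metis le_add1 plus_1_eq_Suc)
  from integral_bind_kernel[OF _ filter_measure_in_space m this, of "Suc t"] show ?thesis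
    by (simp add: predictive_def)
qed

lemma evidence_Suc: "evidence M (Suc t) = evidence M t * norm_const M (Suc t)"
  unfolding evidence_def by simp

text \<open>Splits the evidence into past, present and future. In a nudged model the parameter at
  time \<open>t + 1\<close> enters only through the predictive measure: \<open>evidence M t\<close>
  involves earlier times, \<open>backward\<close> later ones.\<close>

lemma evidence_add_Suc:
  "evidence M (t + Suc n) = evidence M t *
     (\<integral>y. likelihood M (Suc t) y * backward M n (Suc t) y \<partial>predictive M (Suc t))"
proof (induction n arbitrary: t)
  case 0
  show ?case
    by (simp add: evidence_Suc norm_const_def)
next
  case (Suc n)
  have "evidence M (t + Suc (Suc n)) = evidence M (Suc t + Suc n)" by simp
  also have "\<dots> = evidence M (Suc t) *
      (\<integral>x. backward M (Suc n) (Suc t) x \<partial>filter_measure M (Suc t))"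
    unfolding Suc integral_backward_Suc ..
  \<comment> \<open>The last factor of \<open>evidence M (Suc t)\<close> cancels the normalisation
    of the filter at the same time.\<close>
  also have "\<dots> = evidence M t *
      (\<integral>y. likelihood M (Suc t) y * backward M (Suc n) (Suc t) y \<partial>predictive M (Suc t))"
    using norm_const_integral_bayes_update[OF _ predictive_in_space backward_measurable,
        of "Suc t" "Suc t" "Suc n" "Suc t"]
    unfolding evidence_Suc norm_const_def by (simp add: predictive_def mult.assoc)
  finally show ?case .
qed

end

section \<open>Switching on the nudging one time step after another\<close>

lemma initial_nudged_model [simp]: "initial (nudged_model X \<alpha> \<gamma> M) = initial M"
  and likelihood_nudged_model [simp]: "likelihood (nudged_model X \<alpha> \<gamma> M) = likelihood M"
  and kernel_nudged_model: "kernel (nudged_model X \<alpha> \<gamma> M) t x =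
    distr (kernel M t x) (restrict_space borel X) (\<lambda>x'. \<alpha> t x' (\<gamma> t))"
  by (simp_all add: nudged_model_def)

locale nudged_ssm = bounded_ssm +
  fixes \<alpha> :: "nat \<Rightarrow> 'a \<Rightarrow> real \<Rightarrow> 'a"
  assumes continuous_likelihood: "t \<ge> 1 \<Longrightarrow> continuous_on X (likelihood M t)"
    and tv_continuous: "t \<ge> 1 \<Longrightarrow> tv_continuous_kernel X (kernel M t)"
    and nudging: "nudging_family X M \<alpha>"
begin

abbreviation N where "N \<gamma> \<equiv> nudged_model X \<alpha> \<gamma> M"

section \<open>Nudging maps and nudged kernels\<close>

lemma nudge_measurable: "t \<ge> 1 \<Longrightarrow> c \<ge> 0 \<Longrightarrow> (\<lambda>x. \<alpha> t x c) \<in> S \<rightarrow>\<^sub>M S"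
  using nudging unfolding nudging_family_def by blast

lemma nudge_in_X: "t \<ge> 1 \<Longrightarrow> c \<ge> 0 \<Longrightarrow> x \<in> X \<Longrightarrow> \<alpha> t x c \<in> X"
  using measurable_space[OF nudge_measurable] by (simp add: space_S)

text \<open>Continuity at 0 and the limit condition give two limits from the right, which must
  coincide.\<close>

lemma nudge_zero:
  assumes "t \<ge> 1" "x \<in> X"
  shows "\<alpha> t x 0 = x"
proof -
  have c: "continuous_on {0..} (\<alpha> t x)" and l: "(\<alpha> t x \<longlongrightarrow> x) (at_right 0)"
    using nudging assms unfolding nudging_family_def by blast+
  have "(\<alpha> t x \<longlongrightarrow> \<alpha> t x 0) (at 0 within {0..})"
    using c by (simp add: continuous_on_def)
  then have "(\<alpha> t x \<longlongrightarrow> \<alpha> t x 0) (at_right 0)"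
    by (rule tendsto_within_subset) auto
  then show ?thesis
    using l by (intro tendsto_unique[of "at_right 0"]) auto
qed

lemma nudge_tendsto:
  assumes "t \<ge> 1" "x \<in> X" and e: "e \<longlonglongrightarrow> 0" "\<And>k. e k \<ge> 0"
  shows "(\<lambda>k. \<alpha> t x (e k)) \<longlonglongrightarrow> x"
proof -
  have c: "continuous_on {0..} (\<alpha> t x)"
    using nudging assms unfolding nudging_family_def by blast
  have "(\<lambda>k. \<alpha> t x (e k)) \<longlonglongrightarrow> \<alpha> t x 0"
    using e by (intro continuous_on_tendsto_compose[OF c]) auto
  then show ?thesis
    by (simp only: nudge_zero[OF assms(1,2)])
qed

text \<open>Taking the image under a fixed measurable map is a measurable operation on probability
  measures. The sign condition is imposed at all times because the nudging maps are measurable for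
  nonnegative parameters.\<close>

lemma bounded_ssm_nudged:
  assumes "\<And>t. \<gamma> t \<ge> 0"
  shows "bounded_ssm X (N \<gamma>)"
proof
  have "kernel (N \<gamma>) t \<in> S \<rightarrow>\<^sub>M prob_algebra S" if "t \<ge> 1" for t
  proof -
    have "(\<lambda>x. distr (kernel M t x) S (\<lambda>x'. \<alpha> t x' (\<gamma> t))) \<in> S \<rightarrow>\<^sub>M prob_algebra S"
      using measurable_compose[OF kernel_measurable[OF that]
          measurable_distr_prob_space[OF nudge_measurable[OF that assms]]] .
    then show ?thesis
      by (simp add: nudged_model_def)
  qed
  then show "state_space_model X (N \<gamma>)"
    using ssm unfolding state_space_model_def by simp
qed (simp add: bounded_likelihood)

text \<open>The nudging map is only measurable in the state, so it is moved from the kernel into the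
  integrand: what remains is a bounded measurable function integrated against the original kernel,
  which is continuous in total variation.\<close>

lemma backward_nudged_continuous:
  assumes \<gamma>: "\<And>t. \<gamma> t \<ge> 0"
  shows "continuous_on X (backward (N \<gamma>) n t)"
\<comment> \<open>No induction: a single integration against the kernel makes any bounded measurable
  integrand continuous.\<close>
proof (cases n)
  case 0
  then have "backward (N \<gamma>) n t = (\<lambda>_. 1)" by auto
  then show ?thesis by simp
next
  case (Suc m)
  interpret N: bounded_ssm X "N \<gamma>" by (rule bounded_ssm_nudged[OF \<gamma>])
  let ?h = "\<lambda>y. likelihood M (Suc t) y * backward (N \<gamma>) m (Suc t) y"
  let ?a = "\<lambda>y. \<alpha> (Suc t) y (\<gamma> (Suc t))"
  have a: "?a \<in> S \<rightarrow>\<^sub>M S" by (rule nudge_measurable) (simp_all add: \<gamma>)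
  have h: "?h \<in> borel_measurable S"
    using N.backward_measurable likelihood_measurable[of "Suc t"] by auto
  obtain B where B: "\<And>x. x \<in> X \<Longrightarrow> \<bar>?h x\<bar> \<le> B"
    using N.likelihood_backward_bound[of "Suc t"] by (metis le_add1 plus_1_eq_Suc likelihood_nudged_model)
  have "continuous_on X (\<lambda>x. \<integral>y. ?h (?a y) \<partial>kernel M (Suc t) x)"
    using kernel_in_space tv_continuous nudge_in_X \<gamma>
    by (intro continuous_on_integral_tv_continuous_kernel[where B = B]
        measurable_compose[OF a h] B) auto
  moreover have "backward (N \<gamma>) n t x = (\<integral>y. ?h (?a y) \<partial>kernel M (Suc t) x)" if "x \<in> X" for x
  proof -
    have "sets (kernel M (Suc t) x) = sets S"
      using kernel_in_space[of "Suc t" x] that by (auto simp: space_prob_algebra)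
    then have "?a \<in> kernel M (Suc t) x \<rightarrow>\<^sub>M S"
      using a measurable_cong_sets[of "kernel M (Suc t) x" S S S] by auto
    then show ?thesis
      using Suc h by (simp add: kernel_nudged_model integral_distr)
  qed
  ultimately show ?thesis
    by (simp cong: continuous_on_cong)
qed

section \<open>Dependence on the individual parameters\<close>

lemma filter_measure_nudged_cong:
  assumes "\<And>s. s \<in> {1..t} \<Longrightarrow> \<gamma> s = \<gamma>' s"
  shows "filter_measure (N \<gamma>) t = filter_measure (N \<gamma>') t"
  using assms
proof (induction t)
  case (Suc t)
  have "kernel (N \<gamma>) (Suc t) = kernel (N \<gamma>') (Suc t)"
    using Suc.prems[of "Suc t"] by (simp add: nudged_model_def)
  then show ?case
    using Suc by simp
qed simp

lemma norm_const_nudged_cong: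
  assumes "\<And>s. s \<in> {1..t} \<Longrightarrow> \<gamma> s = \<gamma>' s" "t \<ge> 1"
  shows "norm_const (N \<gamma>) t = norm_const (N \<gamma>') t"
proof -
  have "kernel (N \<gamma>) t = kernel (N \<gamma>') t"
    using assms by (simp add: nudged_model_def)
  moreover have "filter_measure (N \<gamma>) (t - 1) = filter_measure (N \<gamma>') (t - 1)"
    using assms by (intro filter_measure_nudged_cong) auto
  ultimately show ?thesis
    by (simp add: norm_const_def predictive_def)
qed

lemma evidence_nudged_cong:
  assumes "\<And>s. s \<in> {1..t} \<Longrightarrow> \<gamma> s = \<gamma>' s"
  shows "evidence (N \<gamma>) t = evidence (N \<gamma>') t"
  unfolding evidence_def by (intro prod.cong refl norm_const_nudged_cong) (auto intro: assms)

lemma backward_nudged_cong: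
  assumes "\<And>s. s > t \<Longrightarrow> \<gamma> s = \<gamma>' s"
  shows "backward (N \<gamma>) n t x = backward (N \<gamma>') n t x"
  using assms
proof (induction n arbitrary: t x)
  case (Suc n)
  have "kernel (N \<gamma>) (Suc t) x = kernel (N \<gamma>') (Suc t) x"
    using Suc.prems[of "Suc t"] by (simp add: nudged_model_def)
  then show ?case
    using Suc.IH[of "Suc t"] Suc.prems by simp
qed simp

text \<open>By \<open>nudge_zero\<close> the kernels agree on \<open>X\<close>, where all filters
  live; outside \<open>X\<close> they may differ, so the argument goes through
  \<open>bind_cong\<close>.\<close>

lemma filter_measure_nudged_zero: "filter_measure (N (\<lambda>_. 0)) t = filter_measure M t"
proof (induction t)
  case (Suc t)
  have "kernel (N (\<lambda>_. 0)) (Suc t) x = kernel M (Suc t) x" if "x \<in> X" for x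
  proof -
    have k: "sets (kernel M (Suc t) x) = sets S"
      using kernel_in_space[of "Suc t" x] that by (auto simp: space_prob_algebra)
    then have "space (kernel M (Suc t) x) = X"
      using sets_eq_imp_space_eq space_S by blast
    then have "distr (kernel M (Suc t) x) S (\<lambda>y. \<alpha> (Suc t) y 0)
        = distr (kernel M (Suc t) x) S (\<lambda>y. y)"
      by (intro distr_cong) (auto simp: nudge_zero)
    also have "\<dots> = kernel M (Suc t) x"
      using k by (intro distr_id2) simp
    finally show ?thesis
      by (simp add: kernel_nudged_model)
  qed
  then have "filter_measure M t \<bind> kernel (N (\<lambda>_. 0)) (Suc t)
      = filter_measure M t \<bind> kernel M (Suc t)"
    by (intro bind_cong) (auto simp: space_filter_measure)
  then show ?case
    using Suc by simp
qed simp

text \<open>Taking images commutes with \<open>bind\<close>, so the current parameter moves from the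
  measure into the integrand. The filter still carries the earlier parameters.\<close>

lemma integral_predictive_nudged:
  fixes h :: "'a \<Rightarrow> real"
  assumes \<gamma>: "\<And>t. \<gamma> t \<ge> 0" and h: "h \<in> borel_measurable S"
  shows "(\<integral>y. h y \<partial>predictive (N \<gamma>) (Suc t)) =
    (\<integral>y. h (\<alpha> (Suc t) y (\<gamma> (Suc t))) \<partial>(filter_measure (N \<gamma>) t \<bind> kernel M (Suc t)))"
proof -
  interpret N: bounded_ssm X "N \<gamma>" by (rule bounded_ssm_nudged[OF \<gamma>])
  let ?F = "filter_measure (N \<gamma>) t"
  have F: "sets ?F = sets S" "space ?F \<noteq> {}"
    using N.filter_measure_in_space[of t]
    by (auto simp: space_subprob_algebra dest: subprob_space.subprob_not_empty)
  have a: "(\<lambda>y. \<alpha> (Suc t) y (\<gamma> (Suc t))) \<in> S \<rightarrow>\<^sub>M S"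
    by (rule nudge_measurable) (simp_all add: \<gamma>)
  have K: "kernel M (Suc t) \<in> ?F \<rightarrow>\<^sub>M subprob_algebra S"
    using kernel_measurable_subprob[of "Suc t"] measurable_cong_sets[OF F(1) refl] by auto
  have "predictive (N \<gamma>) (Suc t) =
      distr (?F \<bind> kernel M (Suc t)) S (\<lambda>y. \<alpha> (Suc t) y (\<gamma> (Suc t)))"
    unfolding distr_bind[OF K F(2) a] by (simp add: predictive_def nudged_model_def)
  moreover have "sets (?F \<bind> kernel M (Suc t)) = sets S"
    using bind_kernel_in_space[OF _ N.filter_measure_in_space, of "Suc t" t]
    by (simp add: space_subprob_algebra)
  then have "(\<lambda>y. \<alpha> (Suc t) y (\<gamma> (Suc t))) \<in> (?F \<bind> kernel M (Suc t)) \<rightarrow>\<^sub>M S"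
    using a measurable_cong_sets by blast
  ultimately show ?thesis
    using h by (simp add: integral_distr)
qed

lemma evidence_nudged_tendsto:
  assumes \<gamma>: "\<And>t. \<gamma> t \<ge> 0" and zero: "\<gamma> (Suc t) = 0"
    and e: "e \<longlonglongrightarrow> 0" "\<And>k. e k \<ge> 0"
  shows "(\<lambda>k. evidence (N (\<gamma>(Suc t := e k))) (t + Suc n)) \<longlonglongrightarrow> evidence (N \<gamma>) (t + Suc n)"
proof -
  interpret N: bounded_ssm X "N \<gamma>" by (rule bounded_ssm_nudged[OF \<gamma>])
  let ?h = "\<lambda>y. likelihood M (Suc t) y * backward (N \<gamma>) n (Suc t) y"
  let ?\<xi> = "filter_measure (N \<gamma>) t \<bind> kernel M (Suc t)"
  have h: "?h \<in> borel_measurable S"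
    using N.backward_measurable likelihood_measurable[of "Suc t"] by auto
  have cont: "continuous_on X ?h"
    using continuous_likelihood[of "Suc t"] backward_nudged_continuous[OF \<gamma>]
    by (intro continuous_on_mult) auto
  obtain B where B: "\<And>x. x \<in> X \<Longrightarrow> \<bar>?h x\<bar> \<le> B"
    using N.likelihood_backward_bound[of "Suc t"] by (metis le_add1 plus_1_eq_Suc likelihood_nudged_model)
  have \<xi>: "?\<xi> \<in> space (subprob_algebra S)"
    by (intro bind_kernel_in_space N.filter_measure_in_space) simp
  then have sets: "sets ?\<xi> = sets S"
    by (simp add: space_subprob_algebra)
  then have space: "space ?\<xi> = X"
    using sets_eq_imp_space_eq space_S by blast
  interpret subprob_space ?\<xi> using \<xi> by (simp add: space_subprob_algebra)
  \<comment> \<open>The factor in front, the measure \<open>?\<xi>\<close> and the function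
    \<open>?h\<close> do not depend on \<open>c\<close>; only the argument of \<open>?h\<close>
    does.\<close>
  have ev: "evidence (N (\<gamma>(Suc t := c))) (t + Suc n) =
      evidence (N \<gamma>) t * (\<integral>y. ?h (\<alpha> (Suc t) y c) \<partial>?\<xi>)" if c: "c \<ge> 0" for c
  proof -
    let ?\<gamma> = "\<gamma>(Suc t := c)"
    have \<gamma>': "?\<gamma> s \<ge> 0" for s using \<gamma> c by simp
    interpret N': bounded_ssm X "N ?\<gamma>" by (rule bounded_ssm_nudged[OF \<gamma>'])
    have b: "backward (N ?\<gamma>) n (Suc t) = backward (N \<gamma>) n (Suc t)"
      by (intro ext backward_nudged_cong) auto
    have f: "filter_measure (N ?\<gamma>) t = filter_measure (N \<gamma>) t"
      by (intro filter_measure_nudged_cong) auto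
    have e: "evidence (N ?\<gamma>) t = evidence (N \<gamma>) t"
      by (intro evidence_nudged_cong) auto
    show ?thesis
      unfolding N'.evidence_add_Suc likelihood_nudged_model b e
      unfolding integral_predictive_nudged[OF \<gamma>' h] f by simp
  qed
  have "(\<lambda>k. \<integral>y. ?h (\<alpha> (Suc t) y (e k)) \<partial>?\<xi>) \<longlonglongrightarrow> (\<integral>y. ?h y \<partial>?\<xi>)"
  \<comment> \<open>The constant \<open>B\<close> is an integrable majorant because
    \<open>?\<xi>\<close> is finite.\<close>
  proof (rule integral_dominated_convergence[where w = "\<lambda>_. B"])
    show "?h \<in> borel_measurable ?\<xi>"
      using h measurable_cong_sets[OF sets refl] by blast
    show "(\<lambda>y. ?h (\<alpha> (Suc t) y (e k))) \<in> borel_measurable ?\<xi>" for k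
      using measurable_compose[OF nudge_measurable[of "Suc t" "e k"] h] e(2)
        measurable_cong_sets[OF sets refl] by auto
    show "AE y in ?\<xi>. (\<lambda>k. ?h (\<alpha> (Suc t) y (e k))) \<longlonglongrightarrow> ?h y"
    proof (rule AE_I2)
      fix y assume "y \<in> space ?\<xi>"
      then have y: "y \<in> X" by (simp add: space)
      show "(\<lambda>k. ?h (\<alpha> (Suc t) y (e k))) \<longlonglongrightarrow> ?h y"
        using y e by (intro continuous_on_tendsto_compose[OF cont] nudge_tendsto always_eventually allI
            nudge_in_X) simp_all
    qed
    show "AE y in ?\<xi>. norm (?h (\<alpha> (Suc t) y (e k))) \<le> B" for k
      using B nudge_in_X e(2) by (intro AE_I2) (simp add: space)
  qed simp
  \<comment> \<open>Writing the limit as nudging with parameter 0 lets \<open>ev\<close> apply to it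
    as well.\<close>
  also have "(\<integral>y. ?h y \<partial>?\<xi>) = (\<integral>y. ?h (\<alpha> (Suc t) y 0) \<partial>?\<xi>)"
    by (intro Bochner_Integration.integral_cong) (auto simp: space nudge_zero)
  finally have "(\<lambda>k. evidence (N (\<gamma>(Suc t := e k))) (t + Suc n))
      \<longlonglongrightarrow> evidence (N (\<gamma>(Suc t := 0))) (t + Suc n)"
    unfolding ev[OF e(2)] ev[OF order_refl] by (rule tendsto_mult_left)
  moreover have "\<gamma>(Suc t := 0) = \<gamma>"
    using zero by auto
  ultimately show ?thesis by simp
qed

text \<open>The gain integral of a nudging family refers to the predictive measure of
  \<open>M\<close>, so it measures the gain while no earlier time is nudged; hence the last time
  comes first. Multiplying by the positive evidence of the earlier times keeps the inequality
  strict.\<close>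

lemma evidence_nudged_last_greater:
  assumes pos: "\<And>t. t \<ge> 1 \<Longrightarrow> norm_const M t > 0"
  shows "\<exists>c>0. evidence (N ((\<lambda>_. 0)(Suc m := c))) (Suc m) > evidence M (Suc m)"
proof -
  obtain \<Gamma> :: "nat \<Rightarrow> real" where \<Gamma>: "\<forall>t\<ge>1. 0 < \<Gamma> t \<and> (\<forall>c\<in>{0<..<\<Gamma> t}.
        (\<integral>x. likelihood M t (\<alpha> t x c) - likelihood M t x \<partial>predictive M t) > 0)"
    using nudging unfolding nudging_family_def by blast
  \<comment> \<open>Any point of the open interval from 0 to \<open>\<Gamma> (Suc m)\<close> would
    do.\<close>
  define c where "c = \<Gamma> (Suc m) / 2"
  have c: "c > 0" "c \<in> {0<..<\<Gamma> (Suc m)}"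
    using \<Gamma> by (auto simp: c_def)
  let ?\<gamma> = "(\<lambda>_. 0)(Suc m := c)"
  let ?g = "likelihood M (Suc m)"
  let ?\<xi> = "predictive M (Suc m)"
  have \<gamma>: "?\<gamma> t \<ge> 0" for t using c by simp
  have \<gamma>0: "(\<lambda>_. 0::real) t \<ge> 0" for t :: nat by simp
  interpret N: bounded_ssm X "N ?\<gamma>" by (rule bounded_ssm_nudged[OF \<gamma>])
  have f: "filter_measure (N ?\<gamma>) t = filter_measure M t" if "t \<le> m" for t
    unfolding filter_measure_nudged_zero[symmetric]
    using that by (intro filter_measure_nudged_cong) auto
  have sets: "sets ?\<xi> = sets S" and sp: "subprob_space ?\<xi>"
    using predictive_in_space[of "Suc m"] by (auto simp: space_subprob_algebra)
  have space: "space ?\<xi> = X"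
    using sets_eq_imp_space_eq[OF sets] space_S by blast
  interpret subprob_space ?\<xi> by (rule sp)
  \<comment> \<open>The new constant integrates the nudged likelihood against the predictive measure
    of \<open>M\<close>, so its excess over the old one is exactly the gain integral.\<close>
  have "norm_const (N ?\<gamma>) (Suc m) = (\<integral>y. ?g (\<alpha> (Suc m) y c) \<partial>?\<xi>)"
    unfolding norm_const_def likelihood_nudged_model
    using integral_predictive_nudged[where \<gamma> = ?\<gamma> and t = m, OF \<gamma> likelihood_measurable[of "Suc m"]] f
    by (simp add: predictive_def)
  moreover have "(\<integral>y. ?g (\<alpha> (Suc m) y c) - ?g y \<partial>?\<xi>) =
      (\<integral>y. ?g (\<alpha> (Suc m) y c) \<partial>?\<xi>) - norm_const M (Suc m)"
  proof -
    obtain B where B: "\<And>x. x \<in> X \<Longrightarrow> \<bar>?g x\<bar> \<le> B"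
      using likelihood_bound[of "Suc m"] by (metis le_add1 plus_1_eq_Suc)
    have "integrable ?\<xi> (\<lambda>y. ?g (\<alpha> (Suc m) y c))"
      using B nudge_in_X[of "Suc m" c] c measurable_cong_sets[OF sets refl]
        measurable_compose[OF nudge_measurable[of "Suc m" c] likelihood_measurable[of "Suc m"]]
      by (intro integrable_const_bound[of _ B]) (auto simp: space)
    then show ?thesis
      using likelihood_integrable[OF _ predictive_in_space, of "Suc m" "Suc m"]
      by (simp add: norm_const_def)
  qed
  ultimately have "norm_const (N ?\<gamma>) (Suc m) > norm_const M (Suc m)"
    using \<Gamma> c by fastforce
  moreover have "evidence (N ?\<gamma>) m = evidence M m"
  proof -
    have "norm_const (N ?\<gamma>) t = norm_const M t" if t: "t \<in> {1..m}" for t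
    proof -
      obtain u where u: "t = Suc u" using t by (cases t) auto
      have "norm_const (N ?\<gamma>) t = (\<integral>y. likelihood M t (\<alpha> t y 0) \<partial>predictive M t)"
        unfolding norm_const_def likelihood_nudged_model
        using integral_predictive_nudged[where \<gamma> = ?\<gamma> and t = u, OF \<gamma> likelihood_measurable[of t]] f t u
        by (simp add: predictive_def)
      also have "\<dots> = norm_const M t"
        using predictive_in_space[of t] t sets_eq_imp_space_eq[of "predictive M t" S]
        unfolding norm_const_def space_subprob_algebra
        by (intro Bochner_Integration.integral_cong) (auto simp: space_S nudge_zero)
      finally show ?thesis .
    qed
    then show ?thesis
      unfolding evidence_def by (intro prod.cong) auto
  qed
  moreover have "evidence M m > 0"
    unfolding evidence_def by (intro prod_pos) (auto intro: pos)
  ultimately have "evidence (N ?\<gamma>) (Suc m) > evidence M (Suc m)"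
    unfolding evidence_Suc N.evidence_Suc by simp
  with c show ?thesis by blast
qed

text \<open>Here \<open>n\<close> counts the times nudged before the last one, going backwards. The
  remaining parameters are kept at exactly 0 so that the continuity result applies at the next time,
  and strictness leaves room for one more small perturbation.\<close>

lemma exists_nudging_evidence_greater:
  assumes pos: "\<And>t. t \<ge> 1 \<Longrightarrow> norm_const M t > 0" and "n \<le> m"
  shows "\<exists>\<gamma>. (\<forall>s. \<gamma> s \<ge> 0) \<and> (\<forall>s\<in>{Suc (m - n)..Suc m}. \<gamma> s > 0) \<and> (\<forall>s\<le>m - n. \<gamma> s = 0) \<and>
    evidence (N \<gamma>) (Suc m) > evidence M (Suc m)"
  using \<open>n \<le> m\<close>
proof (induction n)
  case 0
  obtain c where "c > 0" "evidence (N ((\<lambda>_. 0)(Suc m := c))) (Suc m) > evidence M (Suc m)"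
    using evidence_nudged_last_greater[OF pos] by blast
  then show ?case
    by (intro exI[of _ "(\<lambda>_. 0)(Suc m := c)"]) (simp del: fun_upd_apply, simp)
next
  case (Suc n)
  then obtain \<gamma> where "(\<forall>s. \<gamma> s \<ge> 0) \<and> (\<forall>s\<in>{Suc (m - n)..Suc m}. \<gamma> s > 0) \<and>
      (\<forall>s\<le>m - n. \<gamma> s = 0) \<and> evidence (N \<gamma>) (Suc m) > evidence M (Suc m)"
    using Suc_leD by blast
  then have \<gamma>: "\<And>s. \<gamma> s \<ge> 0" "\<And>s. s \<in> {Suc (m - n)..Suc m} \<Longrightarrow> \<gamma> s > 0"
    "\<And>s. s \<le> m - n \<Longrightarrow> \<gamma> s = 0" "evidence (N \<gamma>) (Suc m) > evidence M (Suc m)"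
    by blast+
  \<comment> \<open>Chosen so that \<open>Suc t\<close> is the latest time not yet nudged.\<close>
  define t where "t = m - Suc n"
  \<comment> \<open>A positive null sequence: each term is an admissible new parameter.\<close>
  define e where "e k = inverse (real (Suc k))" for k
  have m: "m - n = Suc t" "Suc m = t + Suc (Suc n)"
    using Suc.prems by (auto simp: t_def)
  have e: "e \<longlonglongrightarrow> 0"
    unfolding e_def by (rule LIMSEQ_inverse_real_of_nat)
  have "(\<lambda>k. evidence (N (\<gamma>(Suc t := e k))) (Suc m)) \<longlonglongrightarrow> evidence (N \<gamma>) (Suc m)"
    unfolding m(2) using \<gamma> m(1) by (intro evidence_nudged_tendsto e) (auto simp: e_def)
  \<comment> \<open>A limit strictly above \<open>evidence M (Suc m)\<close> forces the terms above
    it eventually; one such term fixes the new parameter.\<close>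
  from eventually_happens'[OF sequentially_bot order_tendstoD(1)[OF this \<gamma>(4)]]
  obtain k where k: "evidence (N (\<gamma>(Suc t := e k))) (Suc m) > evidence M (Suc m)"
    by blast
  have "(\<gamma>(Suc t := e k)) s > 0" if "s \<in> {Suc t..Suc m}" for s
    using \<gamma>(2)[of s] that m(1) by (auto simp: e_def)
  moreover have "(\<gamma>(Suc t := e k)) s = 0" if "s \<le> t" for s
    using \<gamma>(3)[of s] that m(1) by auto
  moreover have "(\<gamma>(Suc t := e k)) s \<ge> 0" for s
    using \<gamma>(1) by (auto simp: e_def)
  ultimately show ?case
    using k unfolding t_def by blast
qed

end

theorem theorem3p1:
  fixes X :: "'a::euclidean_space set"
    and M :: "'a ssm"
    and \<alpha> :: "nat \<Rightarrow> 'a \<Rightarrow> real \<Rightarrow> 'a"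
    and T :: nat
  assumes "state_space_model X M"
    and "\<And>t. t \<ge> 1 \<Longrightarrow> norm_const M t > 0"
    and "\<And>t. t \<ge> 1 \<Longrightarrow> continuous_on X (likelihood M t)"
    and "\<And>t. t \<ge> 1 \<Longrightarrow> bounded (likelihood M t ` X)"
    and "\<And>t. t \<ge> 1 \<Longrightarrow> tv_continuous_kernel X (kernel M t)"
    and "nudging_family X M \<alpha>"
  shows "\<exists>\<gamma> :: nat \<Rightarrow> real.
           (\<forall>t\<in>{1..T}. \<gamma> t > 0) \<and>
           (\<forall>t\<in>{1..T}. norm_const (nudged_model X \<alpha> \<gamma> M) t > 0) \<and>
           evidence (nudged_model X \<alpha> \<gamma> M) T \<ge> evidence M T"
proof (cases T)
  case 0
  then show ?thesis by (simp add: evidence_def)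
next
  case (Suc m)
  interpret nudged_ssm X M \<alpha>
    using assms by unfold_locales
  \<comment> \<open>With \<open>n = m\<close> the positive parameters start at time 1.\<close>
  obtain \<gamma> where "(\<forall>s. \<gamma> s \<ge> 0) \<and> (\<forall>s\<in>{Suc (m - m)..Suc m}. \<gamma> s > 0) \<and>
      evidence (N \<gamma>) (Suc m) > evidence M (Suc m)"
    using exists_nudging_evidence_greater[OF assms(2) order_refl, of m] by blast
  then have \<gamma>: "\<And>s. \<gamma> s \<ge> 0" "\<And>s. s \<in> {1..T} \<Longrightarrow> \<gamma> s > 0"
      "evidence (N \<gamma>) T > evidence M T"
    unfolding Suc by simp_all
  interpret N: bounded_ssm X "N \<gamma>" by (rule bounded_ssm_nudged[OF \<gamma>(1)])
  \<comment> \<open>Positivity of the nudged constants comes for free: their product exceeds a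
    positive number, so none vanishes, and all are nonnegative.\<close>
  have "evidence M T > 0"
    unfolding evidence_def by (intro prod_pos) (auto intro: assms(2))
  then have "evidence (N \<gamma>) T \<noteq> 0"
    using \<gamma>(3) by simp
  then have "norm_const (N \<gamma>) t \<noteq> 0" if "t \<in> {1..T}" for t
    using that unfolding evidence_def by auto
  then have "norm_const (N \<gamma>) t > 0" if "t \<in> {1..T}" for t
    using that N.norm_const_nonneg[of t] by (simp add: order_less_le)
  with \<gamma> show ?thesis
    by (intro exI[of _ \<gamma>]) auto
qed

end
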